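(* (i) For every real $\delta>\frac12$ there is a constant $C_\delta>0$ depending only on $\delta$ such that for all integers $N\ge1$ $$E_N^{2\text{-adic}}\le\frac N2+\delta\log_2(N)+C_\delta N^{2-2\delta}.$$ (ii) There is an absolute constant $C>0$ such that for all integers $N\ge2$ $$E_N^{\mathrm{rat}}\le 2^{\frac N2+C\frac N{\log N}} .$$
   Context: For an integer $N\ge 1$ and a finite binary sequence $\mathcal S^N=(s_0,\dots,s_{N-1})\in\{0,1\}^N$, the $N$th rational complexity is $$\Lambda_{\mathcal S^N}(N)=\min\left\{\max\{|f|,q\}: f,q\in\mathbb Z,\ q>0\text{ odd},\ q\sum_{i=0}^{N-1}s_i2^i\equiv f \bmod 2^N\right\},$$ and the $N$th $2$-adic complexity is $\lambda_{\mathcal S^N}(N)=\log_2\Lambda_{\mathcal S^N}(N)$. The expected values are $$E_N^{\mathrm{rat}}=\frac1{2^N}\sum_{\mathcal S^N\in\{0,1\}^N}\Lambda_{\mathcal S^N}(N),\qquad E_N^{2\text{-adic}}=\frac1{2^N}\sum_{\mathcal S^N\in\{0,1\}^N}\lambda_{\mathcal S^N}(N).$$ Here $\log$ is the natural logarithm. *)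

theory Defs
  imports Complex_Main "HOL-Number_Theory.Cong"
begin

definition binary_seqs :: "nat \<Rightarrow> int list set" where
  "binary_seqs N = {s. length s = N \<and> set s \<subseteq> {0, 1}}"

definition complexity_candidate :: "int list \<Rightarrow> int \<Rightarrow> int \<Rightarrow> bool" where
  "complexity_candidate s f q \<longleftrightarrow>
     q > 0 \<and> odd q \<and> [q * (\<Sum>i<length s. s ! i * 2 ^ i) = f] (mod 2 ^ length s)"

(* The values max |f| q are positive integers, so the minimum is taken over nat. *)
definition rational_complexity :: "int list \<Rightarrow> nat" where
  "rational_complexity s =
     (LEAST m. \<exists>f q. complexity_candidate s f q \<and> int m = max \<bar>f\<bar> q)"

definition two_adic_complexity :: "int list \<Rightarrow> real" where
  "two_adic_complexity s = log 2 (real (rational_complexity s))"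

definition expected_rational_complexity :: "nat \<Rightarrow> real" where
  "expected_rational_complexity N =
     1 / 2 ^ N * (\<Sum>s\<in>binary_seqs N. real (rational_complexity s))"

definition expected_two_adic_complexity :: "nat \<Rightarrow> real" where
  "expected_two_adic_complexity N =
     1 / 2 ^ N * (\<Sum>s\<in>binary_seqs N. two_adic_complexity s)"

lemma finite_binary_seqs: "finite (binary_seqs N)"
  and card_binary_seqs: "card (binary_seqs N) = 2 ^ N"
proof -
  have eq: "binary_seqs N = {s. set s \<subseteq> {0, 1} \<and> length s = N}"
    by (auto simp: binary_seqs_def)
  show "finite (binary_seqs N)"
    unfolding eq by (rule finite_lists_length_eq) simp
  show "card (binary_seqs N) = 2 ^ N"
    unfolding eq by (subst card_lists_length_eq) (simp_all add: numeral_2_eq_2)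
qed

(* The minimum is attained: q = 1 always gives a candidate. *)
lemma rational_complexity_attained:
  "\<exists>f q. complexity_candidate s f q \<and> int (rational_complexity s) = max \<bar>f\<bar> q"
  unfolding rational_complexity_def
proof (rule LeastI_ex)
  let ?S = "\<Sum>i<length s. s ! i * 2 ^ i"
  have "complexity_candidate s ?S 1"
    by (simp add: complexity_candidate_def)
  moreover have "int (nat (max \<bar>?S\<bar> 1)) = max \<bar>?S\<bar> 1"
    by simp
  ultimately show "\<exists>m f q. complexity_candidate s f q \<and> int m = max \<bar>f\<bar> q"
    by blast
qed

lemma rational_complexity_le:
  assumes "complexity_candidate s f q"
  shows "int (rational_complexity s) \<le> max \<bar>f\<bar> q"
proof -
  have "int (nat (max \<bar>f\<bar> q)) = max \<bar>f\<bar> q"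
    by simp
  with assms have "rational_complexity s \<le> nat (max \<bar>f\<bar> q)"
    unfolding rational_complexity_def by (intro Least_le) blast
  then show ?thesis
    by linarith
qed

end

theory Submission
  imports Defs
begin

text \<open>
  Both bounds follow from one stronger estimate: the expected rational complexity is at most
  \<open>8 * 2 powr (N / 2)\<close>.

  Let \<open>S\<close> be the integer with binary digits \<open>s\<close> and \<open>P = 2 ^ N\<close>. Euclid's algorithm on \<open>(P, S)\<close>
  yields remainders, each congruent modulo \<open>P\<close> to \<open>S\<close> times a signed cofactor, and consecutive pairs
  \<open>(r, a)\<close>, \<open>(r', b)\<close> of a remainder and an absolute cofactor satisfy \<open>b * r + a * r' = P\<close>. Let
  \<open>(r', b)\<close> be the first pair whose remainder lies below the square root of \<open>P\<close>; then \<open>b\<close> is at most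
  that root as well. If \<open>b\<close> is odd, this pair is itself an admissible fraction. If \<open>b\<close> is even, then
  the cofactors before and after it are odd, and the relation above bounds the pair before when
  \<open>r' \<le> b\<close> and the pair after otherwise. In all cases the complexity is at most
  \<open>P / max r' b\<close> (\<open>complexity_times_short_vector\<close>).

  So a large complexity forces a very short vector, and few \<open>S\<close> have one: if \<open>b = 2 ^ k * q\<close> with \<open>q\<close>
  odd, then \<open>r' = 2 ^ k * g\<close>, and \<open>(g, q)\<close> with the sign determines \<open>S\<close> modulo \<open>2 ^ (N - k)\<close>, leaving
  only \<open>2 ^ k\<close> values of \<open>S\<close>. This factor cancels the \<open>2 ^ k\<close> in the denominator of
  \<open>P / (2 ^ k * max g q)\<close>. What remains is a sum of \<open>1 / max g q\<close> over a square of side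
  \<open>2 powr (N / 2) / 2 ^ k\<close>, which is linear in the side, and then a geometric series in \<open>k\<close>.

  For the 2-adic complexity, the tangent to the logarithm at \<open>2 powr (N / 2)\<close> turns the bound on
  the expectation into \<open>N / 2\<close> plus a constant. Since \<open>\<delta> * log 2 N\<close> exceeds that constant for all
  large \<open>N\<close>, the term with \<open>C\<close> only has to cover finitely many \<open>N\<close>.
\<close>

section \<open>Binary sequences as integers\<close>

definition seq_value :: "int list \<Rightarrow> int" where
  "seq_value s = (\<Sum>i<length s. s ! i * 2 ^ i)"

lemma seq_value_Nil [simp]: "seq_value [] = 0"
  by (simp add: seq_value_def)

lemma seq_value_Cons [simp]: "seq_value (x # s) = x + 2 * seq_value s"
  by (simp add: seq_value_def sum.lessThan_Suc_shift sum_distrib_left algebra_simps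
           del: sum.lessThan_Suc)

lemma seq_value_bounds:
  assumes "set s \<subseteq> {0, 1}"
  shows "0 \<le> seq_value s \<and> seq_value s < 2 ^ length s"
  using assms by (induction s) auto

lemma seq_value_inject:
  assumes "length s = length t" "set s \<subseteq> {0, 1}" "set t \<subseteq> {0, 1}" "seq_value s = seq_value t"
  shows "s = t"
  using assms
proof (induction s t rule: list_induct2)
  case (Cons x s y t)
  have "x = y"
  proof -
    have "x \<in> {0, 1}" "y \<in> {0, 1}" "x + 2 * seq_value s = y + 2 * seq_value t"
      using Cons.prems by auto
    then show ?thesis by (auto; presburger)
  qed
  then show ?case
    using Cons by simp
qed simp

lemma rational_complexity_le_odd_cofactor:
  assumes "[x = e * c * seq_value s] (mod 2 ^ length s)" "e \<in> {1, -1}" "0 < c" "odd c"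
  shows "int (rational_complexity s) \<le> max \<bar>x\<bar> c"
proof -
  have "[e * x = e * (e * c * seq_value s)] (mod 2 ^ length s)"
    using assms(1) by (rule cong_scalar_left)
  then have "[c * seq_value s = e * x] (mod 2 ^ length s)"
    using assms(2) by (auto simp: cong_sym)
  then have "complexity_candidate s (e * x) c"
    using assms unfolding complexity_candidate_def seq_value_def by blast
  from rational_complexity_le[OF this] show ?thesis
    using assms(2) by auto
qed

section \<open>Euclid's algorithm and short vectors\<close>

text \<open>
  Two consecutive rows \<open>(r, a)\<close> and \<open>(r', b)\<close> of the extended algorithm. The cofactors alternate in
  sign, so \<open>a\<close> and \<open>b\<close> are their absolute values and \<open>e\<close> is the sign of the second one. The equation
  is the determinant of the two rows.
\<close>
definition euclid_state :: "int \<Rightarrow> int \<Rightarrow> int \<Rightarrow> int \<Rightarrow> int \<Rightarrow> int \<Rightarrow> int \<Rightarrow> bool" where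
  "euclid_state P S e r r' a b \<longleftrightarrow>
     e \<in> {1, -1} \<and> [r = - e * a * S] (mod P) \<and> [r' = e * b * S] (mod P) \<and>
     0 \<le> a \<and> a \<le> b \<and> 0 < b \<and> coprime a b \<and> 0 \<le> r' \<and> r' < r \<and> b * r + a * r' = P"

lemma euclid_state_start:
  assumes "0 \<le> S" "S < P"
  shows "euclid_state P S 1 P S 0 1"
  using assms by (auto simp: euclid_state_def cong_def)

lemma euclid_state_next:
  assumes st: "euclid_state P S e r r' a b" and "0 < r'"
  shows "euclid_state P S (- e) r' (r mod r') b (a + r div r' * b)"
proof -
  let ?k = "r div r'"
  note st' = st[unfolded euclid_state_def]
  have k: "1 \<le> ?k"
    using st' \<open>0 < r'\<close> by (simp add: pos_imp_zdiv_pos_iff int_one_le_iff_zero_less)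
  have md: "r mod r' = r - ?k * r'"
    by (simp add: minus_div_mult_eq_mod)
  have "[r - ?k * r' = - e * a * S - ?k * (e * b * S)] (mod P)"
    using st' by (intro cong_diff cong_scalar_left) auto
  then have c: "[r mod r' = - e * (a + ?k * b) * S] (mod P)"
    by (simp add: md algebra_simps)
  have "1 * b \<le> ?k * b"
    using st' k by (intro mult_right_mono) auto
  moreover have "0 \<le> a"
    using st' by blast
  ultimately have le: "b \<le> a + ?k * b"
    by linarith
  have cop: "coprime b (a + ?k * b)"
    using st' by (metis coprime_commute coprime_iff_gcd_eq_1 gcd_add_mult add.commute)
  have det: "(a + ?k * b) * r' + b * (r mod r') = P"
    using st' unfolding md by (simp add: algebra_simps)
  show ?thesis
    unfolding euclid_state_def using st' c le cop det \<open>0 < r'\<close> by auto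
qed

lemma euclid_state_at_sqrt:
  assumes "euclid_state P S e r r' a b" "P \<le> r\<^sup>2"
  shows "\<exists>e r r' a b. euclid_state P S e r r' a b \<and> P \<le> r\<^sup>2 \<and> r'\<^sup>2 < P"
  using assms
proof (induction "nat r'" arbitrary: e r r' a b rule: less_induct)
  case less
  show ?case
  proof (cases "r'\<^sup>2 < P")
    case False
    have "0 < P"
    proof -
      have "0 < b * r" "0 \<le> a * r'" "b * r + a * r' = P"
        using less.prems(1) by (auto simp: euclid_state_def)
      then show ?thesis by linarith
    qed
    with False less.prems(1) have "0 < r'"
      by (cases "r' = 0") (auto simp: euclid_state_def)
    show ?thesis
    proof (rule less.hyps)
      show "euclid_state P S (- e) r' (r mod r') b (a + r div r' * b)"
        using less.prems(1) \<open>0 < r'\<close> by (rule euclid_state_next)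
      show "nat (r mod r') < nat r'"
        using \<open>0 < r'\<close> by simp
      show "P \<le> r'\<^sup>2"
        using False by simp
    qed
  qed (use less.prems in blast)
qed

text \<open>
  Euclid's algorithm is needed rather than a pigeonhole argument because a short vector with
  even \<open>b\<close> is not admissible, and only its neighbours in the algorithm are then controlled.
\<close>
lemma complexity_times_short_vector:
  assumes "set s \<subseteq> {0, 1}"
  obtains e f b where
    "e \<in> {1, -1}" "0 \<le> f" "0 < b" "[f = e * b * seq_value s] (mod 2 ^ length s)"
    "(max f b)\<^sup>2 \<le> 2 ^ length s"
    "int (rational_complexity s) * max f b \<le> 2 ^ length s"
proof -
  let ?P = "2 ^ length s :: int" and ?S = "seq_value s"
  have "euclid_state ?P ?S 1 ?P ?S 0 1"
    using seq_value_bounds[OF assms] by (intro euclid_state_start) auto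
  moreover have "?P \<le> ?P\<^sup>2"
    by (simp add: power2_eq_square)
  ultimately obtain e r r' a b where
    st: "euclid_state ?P ?S e r r' a b" and r: "?P \<le> r\<^sup>2" and r': "r'\<^sup>2 < ?P"
    using euclid_state_at_sqrt by blast
  note st' = st[unfolded euclid_state_def]
  have r'_nonneg: "0 \<le> r'" and b: "0 < b" and a: "0 \<le> a" "a \<le> b" and "r' < r"
    using st' by auto
  have e: "e \<in> {1, -1}"
    using st' by blast
  have det: "b * r + a * r' = ?P"
    using st' by blast
  have br: "b * r \<le> ?P"
    using det a r'_nonneg by (smt (verit) mult_nonneg_nonneg)
  have "b \<le> r"
  proof (rule ccontr)
    assume "\<not> b \<le> r"
    then have "r * r < b * r"
      using \<open>r' < r\<close> r'_nonneg by (intro mult_strict_right_mono) auto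
    with br r show False by (simp add: power2_eq_square)
  qed
  have "b * b \<le> b * r"
    using \<open>b \<le> r\<close> b by (intro mult_left_mono) auto
  with br have b2: "b\<^sup>2 \<le> ?P"
    by (simp add: power2_eq_square)
  let ?L = "int (rational_complexity s)"
  have m2: "(max r' b)\<^sup>2 \<le> ?P"
    using b2 r' by (simp add: max_def)
  have "?L * max r' b \<le> ?P"
  proof (cases "odd b")
    case True
    have "?L \<le> max \<bar>r'\<bar> b"
      using st' True by (intro rational_complexity_le_odd_cofactor[where e = e]) auto
    then have "?L * max r' b \<le> max r' b * max r' b"
      using r'_nonneg b by (intro mult_right_mono) auto
    with m2 show ?thesis by (simp add: power2_eq_square)
  next
    case False
    have "odd a"
      using st' False coprime_common_divisor[of a b 2] by auto
    show ?thesis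
    proof (cases "r' \<le> b")
      case True
      \<comment> \<open>The row before: its remainder satisfies \<open>r \<le> P / b\<close>.\<close>
      have "a \<noteq> 0"
        using \<open>odd a\<close> by auto
      then have "?L \<le> max \<bar>r\<bar> a"
        using st' \<open>odd a\<close> by (intro rational_complexity_le_odd_cofactor[where e = "- e"]) auto
      then have "?L \<le> r"
        using \<open>a \<le> b\<close> \<open>b \<le> r\<close> b by auto
      then have "?L * b \<le> r * b"
        using b by (intro mult_right_mono) auto
      with br True show ?thesis by (simp add: mult.commute max_def)
    next
      case False': False
      \<comment> \<open>The row after: its cofactor satisfies \<open>c \<le> P / r'\<close>.\<close>
      then have "0 < r'"
        using b by linarith
      define c where "c = a + r div r' * b"
      have nxt: "euclid_state ?P ?S (- e) r' (r mod r') b c"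
        unfolding c_def using st \<open>0 < r'\<close> by (rule euclid_state_next)
      note nxt' = nxt[unfolded euclid_state_def]
      have "odd c"
        using \<open>odd a\<close> False by (simp add: c_def)
      then have L: "?L \<le> max \<bar>r mod r'\<bar> c"
        using nxt' by (intro rational_complexity_le_odd_cofactor[where e = "- e"]) auto
      have "c * r' + b * (r mod r') = ?P" "0 \<le> b * (r mod r')"
        using nxt' b by auto
      then have "c * r' \<le> ?P" by linarith
      moreover have "(r mod r') * r' \<le> r' * r'"
        using \<open>0 < r'\<close> by (intro mult_right_mono less_imp_le[OF pos_mod_bound]) auto
      then have "(r mod r') * r' \<le> ?P"
        using r' by (simp add: power2_eq_square)
      ultimately have "max \<bar>r mod r'\<bar> c * r' \<le> ?P"
        using \<open>0 < r'\<close> by (auto simp: max_def)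
      moreover have "?L * r' \<le> max \<bar>r mod r'\<bar> c * r'"
        using L \<open>0 < r'\<close> by (intro mult_right_mono) auto
      ultimately show ?thesis
        using False' by (simp add: max_def)
    qed
  qed
  with that[OF e r'_nonneg b _ m2] st' show ?thesis by blast
qed

section \<open>Summing over short vectors\<close>

text \<open>
  Enlarging the square by one adds a row and a column on which the maximum is constant; each of them
  contributes exactly 1.
\<close>
lemma sum_inverse_max:
  "(\<Sum>g\<le>M. \<Sum>q=1..M. 1 / real (max g q)) = 2 * real M"
proof (induction M)
  case (Suc M)
  have "(\<Sum>g\<le>Suc M. \<Sum>q=1..Suc M. 1 / real (max g q)) =
        (\<Sum>g\<le>M. (\<Sum>q=1..M. 1 / real (max g q)) + 1 / real (max g (Suc M))) +
        (\<Sum>q=1..Suc M. 1 / real (max (Suc M) q))"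
    unfolding sum.atMost_Suc by (simp del: of_nat_max)
  also have "(\<Sum>q=1..Suc M. 1 / real (max (Suc M) q)) = (\<Sum>q=1..Suc M. 1 / real (Suc M))"
    by (intro sum.cong refl) (simp add: max_def)
  also have "\<dots> = 1" by (simp del: sum.cl_ivl_Suc)
  also have "(\<Sum>g\<le>M. (\<Sum>q=1..M. 1 / real (max g q)) + 1 / real (max g (Suc M))) =
             2 * real M + (\<Sum>g\<le>M. 1 / real (max g (Suc M)))"
    by (simp only: sum.distrib Suc.IH)
  also have "(\<Sum>g\<le>M. 1 / real (max g (Suc M))) = (\<Sum>g\<le>M. 1 / real (Suc M))"
    by (intro sum.cong refl) (simp add: max_def)
  also have "\<dots> = 1" by (simp del: sum.cl_ivl_Suc)
  finally show ?case by simp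
qed simp

text \<open>
  An odd \<open>q\<close> is invertible modulo \<open>2 ^ (N - k)\<close>, so the congruence fixes all but the last \<open>k\<close>
  entries of the sequence.
\<close>
lemma card_binary_seqs_cong:
  assumes "k \<le> N" "odd q" "e \<in> {1, -1 :: int}"
  shows "card {s \<in> binary_seqs N. [g = e * q * seq_value s] (mod 2 ^ (N - k))} \<le> 2 ^ k"
    (is "card ?A \<le> _")
proof -
  let ?m = "2 ^ (N - k) :: int"
  let ?h = "\<lambda>s. nat (seq_value s div ?m)"
  have split: "(2 ^ N :: int) = 2 ^ k * ?m"
    using assms(1) by (simp flip: power_add)
  have "inj_on ?h ?A"
  proof (rule inj_onI)
    fix s t assume s: "s \<in> ?A" and t: "t \<in> ?A" and eq: "?h s = ?h t"
    have bs: "0 \<le> seq_value s" "0 \<le> seq_value t"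
      using s t seq_value_bounds by (auto simp: binary_seqs_def)
    have "[e * q * seq_value s = e * q * seq_value t] (mod ?m)"
      using s t by (auto intro: cong_trans cong_sym)
    moreover have "coprime (e * q) ?m"
      using assms(2,3) by (auto simp: coprime_commute)
    ultimately have "[seq_value s = seq_value t] (mod ?m)"
      by (simp add: cong_mult_lcancel)
    moreover have "seq_value s div ?m = seq_value t div ?m"
      using eq bs by (simp add: eq_nat_nat_iff pos_imp_zdiv_nonneg_iff)
    ultimately have "seq_value s = seq_value t"
      unfolding cong_def by (metis mult_div_mod_eq)
    then show "s = t"
      using s t by (intro seq_value_inject) (auto simp: binary_seqs_def)
  qed
  moreover have "?h ` ?A \<subseteq> {..<2 ^ k}"
  proof safe
    fix s assume "s \<in> binary_seqs N"
    then have "0 \<le> seq_value s" "seq_value s < 2 ^ k * ?m"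
      using seq_value_bounds[of s] by (auto simp: binary_seqs_def split)
    moreover have "seq_value s div ?m * ?m \<le> seq_value s"
      by (simp flip: minus_mod_eq_div_mult)
    ultimately have "seq_value s div ?m * ?m < 2 ^ k * ?m"
      by linarith
    then have "seq_value s div ?m < 2 ^ k"
      by (simp only: mult_less_cancel_right_pos zero_less_power zero_less_numeral)
    then show "?h s < 2 ^ k"
      by (simp add: nat_less_iff pos_imp_zdiv_nonneg_iff \<open>0 \<le> seq_value s\<close>)
  qed
  ultimately have "card ?A \<le> card {..<2 ^ k :: nat}"
    by (intro card_inj_on_le) auto
  then show ?thesis by simp
qed

text \<open>
  The common power of two is removed from the short vector, so that the cofactor becomes odd and the
  preceding count applies.
\<close>
lemma reduced_short_vector:
  assumes "s \<in> binary_seqs N"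
  obtains e k g q where
    "e \<in> {1, -1 :: int}" "k \<le> N" "odd (q :: nat)" "[int g = e * int q * seq_value s] (mod 2 ^ (N - k))"
    "real (max g q) \<le> sqrt (2 ^ N) / 2 ^ k"
    "real (rational_complexity s) \<le> 2 ^ N / (2 ^ k * real (max g q))"
proof -
  have s: "set s \<subseteq> {0, 1}" "length s = N"
    using assms by (auto simp: binary_seqs_def)
  obtain e f b where e: "e \<in> {1, -1}" and f: "0 \<le> f" and b: "0 < b"
    and cong: "[f = e * b * seq_value s] (mod 2 ^ N)"
    and m2: "(max f b)\<^sup>2 \<le> 2 ^ N" and L: "int (rational_complexity s) * max f b \<le> 2 ^ N"
    using complexity_times_short_vector[OF s(1)] s(2) by metis
  define k where "k = multiplicity 2 b"
  obtain q' where q': "b = 2 ^ k * q'" "odd q'"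
    unfolding k_def using b multiplicity_decompose'[of b 2] by auto
  have "0 < q'"
    using b q' by (simp add: zero_less_mult_iff)
  have "k \<le> N"
  proof -
    have "(2 :: int) ^ k \<le> b"
      using q' \<open>0 < q'\<close> by simp
    also have "b \<le> (max f b)\<^sup>2"
      using b by (smt (verit) self_le_power zero_less_numeral)
    also note m2
    finally show ?thesis by simp
  qed
  have split: "(2 ^ N :: int) = 2 ^ k * 2 ^ (N - k)"
    using \<open>k \<le> N\<close> by (simp flip: power_add)
  have "(2 ^ k :: int) dvd f"
  proof -
    have "[f = e * b * seq_value s] (mod 2 ^ k)"
      using cong by (rule cong_dvd_modulus) (simp add: split)
    moreover have "2 ^ k dvd e * b * seq_value s"
      using q' by simp
    ultimately show ?thesis by (simp add: cong_dvd_iff)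
  qed
  then obtain g' where g': "f = 2 ^ k * g'" by blast
  have "0 \<le> g'"
    using f g' by (simp add: zero_le_mult_iff)
  have "[2 ^ k * g' = 2 ^ k * (e * q' * seq_value s)] (mod (2 ^ k * 2 ^ (N - k)))"
    using cong by (simp add: g' q' split mult_ac)
  then have cong': "[g' = e * q' * seq_value s] (mod 2 ^ (N - k))"
    by (simp add: cong_iff_dvd_diff flip: right_diff_distrib)
  define g q where "g = nat g'" and "q = nat q'"
  have gq: "g' = int g" "q' = int q"
    using \<open>0 \<le> g'\<close> \<open>0 < q'\<close> by (simp_all add: g_def q_def)
  have "0 < max g q"
    using \<open>0 < q'\<close> gq by simp
  have "max f b = int (2 ^ k * max g q)"
    unfolding g' q'(1) gq by (simp add: max_def)
  with m2 L have "int ((2 ^ k * max g q)\<^sup>2) \<le> int (2 ^ N)"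
    and "int (rational_complexity s * (2 ^ k * max g q)) \<le> int (2 ^ N)" by simp_all
  then have nat_m2: "(2 ^ k * max g q)\<^sup>2 \<le> 2 ^ N"
    and nat_L: "rational_complexity s * (2 ^ k * max g q) \<le> 2 ^ N"
    by (simp_all only: of_nat_le_iff)
  have real_m2: "(2 ^ k * real (max g q))\<^sup>2 \<le> 2 ^ N"
    using of_nat_mono[OF nat_m2, where 'a = real] by (simp del: of_nat_max)
  have real_L: "real (rational_complexity s) * (2 ^ k * real (max g q)) \<le> 2 ^ N"
    using of_nat_mono[OF nat_L, where 'a = real] by (simp del: of_nat_max)
  show ?thesis
  proof
    show "e \<in> {1, -1}" "k \<le> N" by fact+
    show "odd q" using q' gq by simp
    show "[int g = e * int q * seq_value s] (mod 2 ^ (N - k))" using cong' gq by simp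
    show "real (max g q) \<le> sqrt (2 ^ N) / 2 ^ k"
      using real_le_rsqrt[OF real_m2] by (simp add: field_simps del: of_nat_max)
    show "real (rational_complexity s) \<le> 2 ^ N / (2 ^ k * real (max g q))"
      using real_L \<open>0 < max g q\<close> by (subst pos_le_divide_eq) (auto simp del: of_nat_max)
  qed
qed

text \<open>
  Each complexity is bounded by the sum of the weights \<open>w\<close> of all reduced vectors that fit the
  sequence. After exchanging the sums, each vector is counted at most \<open>2 ^ k\<close> times. The constant is
  2 for the signs, times 2 from \<open>sum_inverse_max\<close>, times 2 from the geometric series.
\<close>
theorem expected_rational_complexity_le:
  "expected_rational_complexity N \<le> 8 * 2 powr (real N / 2)"
proof -
  define B where "B = sqrt (2 ^ N)"
  define M where "M k = nat \<lfloor>B / 2 ^ k\<rfloor>" for k :: nat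
  define I where "I = (SIGMA k:{..N}. {1, -1 :: int} \<times> {..M k} \<times> {q \<in> {1..M k}. odd q})"
  define hit where "hit s k e g q \<longleftrightarrow> [int g = e * int q * seq_value s] (mod 2 ^ (N - k))"
    for s k e and g q :: nat
  define w where "w k g q = 2 ^ N / (2 ^ k * real (max g q))" for k g q :: nat
  define F where "F s = (\<lambda>(k, e, g, q). if hit s k e g q then w k g q else 0)" for s
  have fin: "finite I"
    by (auto simp: I_def)
  have w_nonneg: "0 \<le> w k g q" for k g q
    unfolding w_def by (intro divide_nonneg_nonneg mult_nonneg_nonneg) auto
  have pointwise: "real (rational_complexity s) \<le> sum (F s) I" if s: "s \<in> binary_seqs N" for s
  proof -
    obtain e :: int and k g q where e: "e \<in> {1, -1}" and k: "k \<le> N" and q: "odd q"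
      and h: "[int g = e * int q * seq_value s] (mod 2 ^ (N - k))"
      and m: "real (max g q) \<le> sqrt (2 ^ N) / 2 ^ k"
      and L: "real (rational_complexity s) \<le> 2 ^ N / (2 ^ k * real (max g q))"
      by (rule reduced_short_vector[OF s])
    have "max g q \<le> M k"
      unfolding M_def B_def using m by (rule le_nat_floor)
    moreover have "1 \<le> q"
      using q by (cases q) auto
    ultimately have i: "(k, e, g, q) \<in> I"
      using e k q by (auto simp: I_def)
    have "real (rational_complexity s) \<le> F s (k, e, g, q)"
      using L h unfolding F_def hit_def w_def by simp
    also have "\<dots> \<le> sum (F s) I"
      using w_nonneg by (intro member_le_sum[OF i _ fin]) (simp add: F_def split_def)
    finally show ?thesis .
  qed
  have multiplicity_bound:
    "(\<Sum>s\<in>binary_seqs N. F s i) \<le> (case i of (k, e, g, q) \<Rightarrow> 2 ^ N / real (max g q))"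
    if "i \<in> I" for i
  proof -
    obtain k e g q where i: "i = (k, e, g, q)"
      by (cases i) auto
    have ke: "k \<le> N" "e \<in> {1, -1}" "odd q"
      using that by (auto simp: i I_def)
    have "(\<Sum>s\<in>binary_seqs N. F s i) = real (card {s \<in> binary_seqs N. hit s k e g q}) * w k g q"
      by (simp add: i F_def finite_binary_seqs flip: sum.inter_filter)
    also have "\<dots> \<le> 2 ^ k * w k g q"
    proof (rule mult_right_mono[OF _ w_nonneg])
      have "card {s \<in> binary_seqs N. hit s k e g q} \<le> 2 ^ k"
        unfolding hit_def using ke by (intro card_binary_seqs_cong) auto
      from of_nat_mono[OF this, where 'a = real]
      show "real (card {s \<in> binary_seqs N. hit s k e g q}) \<le> 2 ^ k" by simp
    qed
    also have "\<dots> = 2 ^ N / real (max g q)"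
      by (simp add: w_def del: of_nat_max)
    finally show ?thesis by (simp add: i del: of_nat_max)
  qed
  have "(\<Sum>s\<in>binary_seqs N. real (rational_complexity s)) \<le> (\<Sum>s\<in>binary_seqs N. sum (F s) I)"
    by (intro sum_mono pointwise)
  also have "\<dots> = (\<Sum>i\<in>I. \<Sum>s\<in>binary_seqs N. F s i)"
    by (rule sum.swap)
  also have "\<dots> \<le> (\<Sum>i\<in>I. case i of (k, e, g, q) \<Rightarrow> 2 ^ N / real (max g q))"
    by (intro sum_mono multiplicity_bound)
  also have "\<dots> = (\<Sum>k\<le>N. \<Sum>e\<in>{1, -1 :: int}. \<Sum>g\<le>M k. \<Sum>q | q \<in> {1..M k} \<and> odd q.
      2 ^ N / real (max g q))"
    unfolding I_def sum.cartesian_product by (subst sum.Sigma) auto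
  also have "\<dots> \<le> (\<Sum>k\<le>N. \<Sum>e\<in>{1, -1 :: int}. \<Sum>g\<le>M k. \<Sum>q=1..M k. 2 ^ N / real (max g q))"
    by (intro sum_mono sum_mono2) auto
  also have "\<dots> = (\<Sum>k\<le>N. 2 ^ N * (4 * real (M k)))"
  proof (rule sum.cong)
    fix k
    have "(\<Sum>g\<le>M k. \<Sum>q=1..M k. 2 ^ N / real (max g q)) =
          2 ^ N * (\<Sum>g\<le>M k. \<Sum>q=1..M k. 1 / real (max g q))"
      unfolding sum_distrib_left by simp
    then show "(\<Sum>e\<in>{1, -1 :: int}. \<Sum>g\<le>M k. \<Sum>q=1..M k. 2 ^ N / real (max g q)) =
        2 ^ N * (4 * real (M k))"
      unfolding sum_inverse_max by simp
  qed simp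
  also have "\<dots> \<le> (\<Sum>k\<le>N. 2 ^ N * (4 * (B * (1 / 2) ^ k)))"
  proof (intro sum_mono mult_left_mono)
    fix k
    have "0 \<le> B / 2 ^ k"
      by (simp add: B_def)
    then have "real (M k) \<le> B / 2 ^ k"
      unfolding M_def by linarith
    then show "real (M k) \<le> B * (1 / 2) ^ k"
      by (simp add: power_divide)
  qed auto
  also have "\<dots> = 2 ^ N * (4 * B) * (\<Sum>k\<le>N. (1 / 2) ^ k)"
    unfolding sum_distrib_left by (simp only: mult.assoc)
  also have "\<dots> \<le> 2 ^ N * (4 * B) * 2"
  proof (rule mult_left_mono)
    show "(\<Sum>k\<le>N. (1 / 2 :: real) ^ k) \<le> 2"
      by (simp add: sum_gp0)
  qed (simp add: B_def)
  finally have "expected_rational_complexity N \<le> 8 * B"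
    unfolding expected_rational_complexity_def by (simp add: field_simps)
  also have "B = (2 powr real N) powr (1 / 2)"
    unfolding B_def by (simp add: powr_half_sqrt powr_realpow)
  also have "\<dots> = 2 powr (real N / 2)"
    by (simp only: powr_powr) simp
  finally show ?thesis .
qed

section \<open>The two expectations\<close>

lemma rational_complexity_pos: "0 < rational_complexity s"
  using rational_complexity_attained[of s] unfolding complexity_candidate_def by force

text \<open>
  The tangent to the logarithm at \<open>c = 2 powr (N / 2)\<close> gives \<open>log 2 x \<le> N / 2 + (x / c - 1) / ln 2\<close>.
  Averaging over \<open>x\<close> with mean at most \<open>8 * c\<close> produces the constant \<open>(8 - 1) / ln 2\<close>.
\<close>
lemma expected_two_adic_complexity_le:
  "expected_two_adic_complexity N \<le> real N / 2 + 7 / ln 2"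
proof -
  define c where "c = 2 powr (real N / 2)"
  have "c > 0" by (simp add: c_def)
  have tangent: "two_adic_complexity s \<le> real N / 2 - 1 / ln 2 + real (rational_complexity s) * (1 / (c * ln 2))"
    for s
  proof -
    let ?x = "real (rational_complexity s)"
    have "?x > 0"
      using rational_complexity_pos by simp
    then have "ln (?x / c) \<le> ?x / c - 1"
      using \<open>c > 0\<close> by (intro ln_le_minus_one) simp
    then have "log 2 (?x / c) \<le> (?x / c - 1) / ln 2"
      by (simp add: log_def divide_right_mono)
    moreover have "log 2 (?x / c) = log 2 ?x - real N / 2"
      using \<open>?x > 0\<close> by (simp add: log_divide c_def)
    ultimately show ?thesis
      by (simp add: two_adic_complexity_def diff_divide_distrib)
  qed
  have "(\<Sum>s\<in>binary_seqs N. two_adic_complexity s) \<le>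
    (\<Sum>s\<in>binary_seqs N. real N / 2 - 1 / ln 2 + real (rational_complexity s) * (1 / (c * ln 2)))"
    by (intro sum_mono tangent)
  also have "\<dots> = 2 ^ N * (real N / 2 - 1 / ln 2) +
      (\<Sum>s\<in>binary_seqs N. real (rational_complexity s)) * (1 / (c * ln 2))"
    unfolding sum.distrib sum_distrib_right[symmetric] by (simp add: card_binary_seqs)
  finally have "expected_two_adic_complexity N \<le>
      1 / 2 ^ N * (2 ^ N * (real N / 2 - 1 / ln 2) +
        (\<Sum>s\<in>binary_seqs N. real (rational_complexity s)) * (1 / (c * ln 2)))"
    unfolding expected_two_adic_complexity_def by (intro mult_left_mono) auto
  also have "\<dots> = real N / 2 - 1 / ln 2 + expected_rational_complexity N * (1 / (c * ln 2))"
    unfolding expected_rational_complexity_def by (simp add: distrib_left)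
  also have "\<dots> \<le> real N / 2 - 1 / ln 2 + 8 * c * (1 / (c * ln 2))"
    using expected_rational_complexity_le[of N] \<open>c > 0\<close>
    by (intro add_left_mono mult_right_mono) (auto simp: c_def)
  also have "\<dots> = real N / 2 + 7 / ln 2"
    using \<open>c > 0\<close> by (simp add: field_simps)
  finally show ?thesis .
qed

lemma const_le_log_plus_powr:
  fixes K \<delta> :: real
  assumes "0 < K" "1 / 2 < \<delta>"
  shows "\<exists>C>0. \<forall>N\<ge>1. K \<le> \<delta> * log 2 (real N) + C * real N powr (2 - 2 * \<delta>)"
proof -
  \<comment> \<open>From this threshold on, \<open>\<delta> * log 2 N \<ge> K\<close> for every \<open>\<delta> > 1 / 2\<close>.\<close>
  define T where "T = 2 powr (2 * K)"
  \<comment> \<open>Below it, \<open>N powr (2 - 2 * \<delta>) \<ge> N powr (- 2 * \<delta>) \<ge> T powr (- 2 * \<delta>)\<close>, whatever the sign of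
     \<open>2 - 2 * \<delta>\<close>.\<close>
  define C where "C = K * T powr (2 * \<delta>)"
  have "T > 0" by (simp add: T_def)
  have "C > 0" using assms(1) \<open>T > 0\<close> by (simp add: C_def)
  moreover have "K \<le> \<delta> * log 2 (real N) + C * real N powr (2 - 2 * \<delta>)" if "1 \<le> N" for N :: nat
  proof (cases "T \<le> real N")
    case True
    have "2 * K = log 2 T" by (simp add: T_def)
    also have "\<dots> \<le> log 2 (real N)"
      using True \<open>T > 0\<close> that by simp
    finally have "1 / 2 * (2 * K) \<le> \<delta> * log 2 (real N)"
      using assms by (intro mult_mono) auto
    moreover have "0 \<le> C * real N powr (2 - 2 * \<delta>)"
      using \<open>C > 0\<close> by simp
    ultimately show ?thesis by linarith
  next
    case False
    have "T powr (- (2 * \<delta>)) \<le> real N powr (- (2 * \<delta>))"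
      using False that assms by (intro powr_mono2') auto
    also have "\<dots> \<le> real N powr (2 - 2 * \<delta>)"
      using that by (intro powr_mono) auto
    finally have "C * T powr (- (2 * \<delta>)) \<le> C * real N powr (2 - 2 * \<delta>)"
      using \<open>C > 0\<close> by (intro mult_left_mono) auto
    moreover have "C * T powr (- (2 * \<delta>)) = K"
      using \<open>T > 0\<close> by (simp add: C_def powr_minus field_simps)
    moreover have "0 \<le> \<delta> * log 2 (real N)"
      using assms that by simp
    ultimately show ?thesis by linarith
  qed
  ultimately show ?thesis by blast
qed

theorem theorem3:
  shows "(\<forall>\<delta>::real. \<delta> > 1 / 2 \<longrightarrow>
           (\<exists>C::real. C > 0 \<and> (\<forall>N::nat. N \<ge> 1 \<longrightarrow>
              expected_two_adic_complexity N
                \<le> real N / 2 + \<delta> * log 2 (real N) + C * real N powr (2 - 2 * \<delta>)))) \<and>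
         (\<exists>C::real. C > 0 \<and> (\<forall>N::nat. N \<ge> 2 \<longrightarrow>
              expected_rational_complexity N
                \<le> 2 powr (real N / 2 + C * (real N / ln (real N)))))"
proof (intro conjI allI impI)
  fix \<delta> :: real assume "\<delta> > 1 / 2"
  then obtain C where C: "C > 0"
    "\<And>N::nat. 1 \<le> N \<Longrightarrow> 7 / ln 2 \<le> \<delta> * log 2 (real N) + C * real N powr (2 - 2 * \<delta>)"
    using const_le_log_plus_powr[of "7 / ln 2" \<delta>] by auto
  have "expected_two_adic_complexity N
      \<le> real N / 2 + \<delta> * log 2 (real N) + C * real N powr (2 - 2 * \<delta>)" if "1 \<le> N" for N :: nat
    using expected_two_adic_complexity_le[of N] C(2)[OF that] by linarith
  with C(1) show "\<exists>C>0. \<forall>N\<ge>1. expected_two_adic_complexity N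
      \<le> real N / 2 + \<delta> * log 2 (real N) + C * real N powr (2 - 2 * \<delta>)" by blast
next
  \<comment> \<open>The factor \<open>8 = 2 ^ 3\<close> is absorbed because \<open>N / ln N \<ge> 1\<close>.\<close>
  have "expected_rational_complexity N \<le> 2 powr (real N / 2 + 3 * (real N / ln (real N)))"
    if "2 \<le> N" for N :: nat
  proof -
    have "ln (real N) > 0" "ln (real N) \<le> real N - 1"
      using that by (auto intro: ln_le_minus_one)
    then have "1 \<le> real N / ln (real N)"
      by (simp add: field_simps)
    then have "2 powr (real N / 2 + 3) \<le> 2 powr (real N / 2 + 3 * (real N / ln (real N)))"
      by (intro powr_mono) auto
    moreover have "2 powr (real N / 2 + 3) = 8 * 2 powr (real N / 2)"
      by (simp add: powr_add)
    ultimately show ?thesis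
      using expected_rational_complexity_le[of N] by linarith
  qed
  then show "\<exists>C>0. \<forall>N\<ge>2. expected_rational_complexity N
      \<le> 2 powr (real N / 2 + C * (real N / ln (real N)))"
    by (intro exI[of _ "3 :: real"]) auto
qed

end
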